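(* Let $\chi$ be a probability distribution on $\mathbb{N}_0$ with $0\le\chi(0)<1$ and probability generating function $G(x)=\sum_{m=0}^{\infty}x^m\chi(m)$, and let $(p,q)\in[0,1]^2$ with $0<p+q<1$. Define $g_{p,q}:[0,1]\to[0,1]$ by $g_{p,q}(x)=(1-q)-(1-p-q)G(x)$ and let $g_{p,q}^{(2)}=g_{p,q}\circ g_{p,q}$. Let $w=w(p,q)$ be the probability that the bond percolation game with parameter-pair $(p,q)$ on the rooted Galton-Watson tree $T_\chi$, starting with the token at the root $\phi$, is won by the player who plays the first round, and let $\ell=\ell(p,q)$ be the probability that it is lost by the player who plays the first round. Then: (1) $w'=p+(1-p-q)w$ equals the minimum positive fixed point of $g_{p,q}^{(2)}$; (2) $\ell'=(1-p-q)\ell$ equals $(1-q)-g_{p,q}(w')$; (3) the probability that this game results in a draw is $0$ if and only if $g_{p,q}^{(2)}$ has a unique fixed point in $[0,1]$.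
   Context: $\mathbb{N}_0=\{0,1,2,\dots\}$. $T_\chi$ is the rooted Galton-Watson tree with root $\phi$ in which the numbers of children of the vertices are i.i.d. with law $\chi$. Each edge $\{u,v\}$ ($u$ the parent of $v$) is directed from $u$ to $v$. Bond percolation game with parameter-pair $(p,q)$: given $T_\chi$, each edge is independently labeled trap with probability $p$, target with probability $q$, safe with probability $1-p-q$. The tree and all labels are revealed to both players (perfect information). Two players alternately move a token; a move takes the token from its current vertex $u$ along a directed edge to a child of $u$. A player who moves the token along a target edge wins immediately; a player who moves it along a trap edge loses immediately; a player whose turn it is to move when the token is at a leaf (childless vertex) loses. If the game continues forever it is a draw. Both players play optimally: for a given realization, the game is won (respectively lost) by the first player if the first (respectively second) player has a strategy guaranteeing a win for herself in finitely many rounds against any play of the opponent; otherwise the game results in a draw. *)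

theory Defs
  imports "HOL-Probability.Probability"
begin

datatype label = Trap | Target | Safe

text \<open>
  Ulam--Harris encoding: a vertex is the list of child indices leading to it from the root
  \<open>[]\<close>, so a vertex of the tree also records the whole history of a play reaching it.  A
  configuration \<open>\<omega>\<close> attaches to every potential vertex \<open>v\<close> its number of children and the label
  of the edge from the parent of \<open>v\<close> to \<open>v\<close>.  The label stored at the root, and all data stored
  outside \<open>gw_tree \<omega>\<close>, are irrelevant.
\<close>

type_synonym vertex = "nat list"
type_synonym configuration = "vertex \<Rightarrow> nat \<times> label"

definition children :: "configuration \<Rightarrow> vertex \<Rightarrow> vertex set" where
  "children \<omega> v = {v @ [i] | i. i < fst (\<omega> v)}"

definition edge_label :: "configuration \<Rightarrow> vertex \<Rightarrow> label" where
  "edge_label \<omega> v = snd (\<omega> v)"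

inductive_set gw_tree :: "configuration \<Rightarrow> vertex set" for \<omega> :: configuration where
  root: "[] \<in> gw_tree \<omega>"
| child: "v \<in> gw_tree \<omega> \<Longrightarrow> u \<in> children \<omega> v \<Longrightarrow> u \<in> gw_tree \<omega>"

definition strategy :: "configuration \<Rightarrow> (vertex \<Rightarrow> vertex) \<Rightarrow> bool" where
  "strategy \<omega> \<sigma> \<longleftrightarrow> (\<forall>v\<in>gw_tree \<omega>. children \<omega> v \<noteq> {} \<longrightarrow> \<sigma> v \<in> children \<omega> v)"

text \<open>
  Rounds are numbered from 0 and the first player moves in the even ones.  The token is at
  \<open>position \<sigma> \<tau> n\<close> before round \<open>n\<close>; this is meaningful only as long as the game has not ended.
\<close>

fun position :: "(vertex \<Rightarrow> vertex) \<Rightarrow> (vertex \<Rightarrow> vertex) \<Rightarrow> nat \<Rightarrow> vertex" where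
  "position \<sigma> \<tau> 0 = []"
| "position \<sigma> \<tau> (Suc n) = (if even n then \<sigma> else \<tau>) (position \<sigma> \<tau> n)"

definition reaches_round ::
    "configuration \<Rightarrow> (vertex \<Rightarrow> vertex) \<Rightarrow> (vertex \<Rightarrow> vertex) \<Rightarrow> nat \<Rightarrow> bool" where
  "reaches_round \<omega> \<sigma> \<tau> n \<longleftrightarrow>
     (\<forall>m<n. children \<omega> (position \<sigma> \<tau> m) \<noteq> {} \<and>
            edge_label \<omega> (position \<sigma> \<tau> (Suc m)) = Safe)"

definition mover_wins_in_round ::
    "configuration \<Rightarrow> (vertex \<Rightarrow> vertex) \<Rightarrow> (vertex \<Rightarrow> vertex) \<Rightarrow> nat \<Rightarrow> bool" where
  "mover_wins_in_round \<omega> \<sigma> \<tau> n \<longleftrightarrow>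
     reaches_round \<omega> \<sigma> \<tau> n \<and> children \<omega> (position \<sigma> \<tau> n) \<noteq> {} \<and>
     edge_label \<omega> (position \<sigma> \<tau> (Suc n)) = Target"

definition mover_loses_in_round ::
    "configuration \<Rightarrow> (vertex \<Rightarrow> vertex) \<Rightarrow> (vertex \<Rightarrow> vertex) \<Rightarrow> nat \<Rightarrow> bool" where
  "mover_loses_in_round \<omega> \<sigma> \<tau> n \<longleftrightarrow>
     reaches_round \<omega> \<sigma> \<tau> n \<and>
     (children \<omega> (position \<sigma> \<tau> n) = {} \<or> edge_label \<omega> (position \<sigma> \<tau> (Suc n)) = Trap)"

definition first_wins_play ::
    "configuration \<Rightarrow> (vertex \<Rightarrow> vertex) \<Rightarrow> (vertex \<Rightarrow> vertex) \<Rightarrow> bool" where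
  "first_wins_play \<omega> \<sigma> \<tau> \<longleftrightarrow>
     (\<exists>n. even n \<and> mover_wins_in_round \<omega> \<sigma> \<tau> n \<or> odd n \<and> mover_loses_in_round \<omega> \<sigma> \<tau> n)"

definition second_wins_play ::
    "configuration \<Rightarrow> (vertex \<Rightarrow> vertex) \<Rightarrow> (vertex \<Rightarrow> vertex) \<Rightarrow> bool" where
  "second_wins_play \<omega> \<sigma> \<tau> \<longleftrightarrow>
     (\<exists>n. odd n \<and> mover_wins_in_round \<omega> \<sigma> \<tau> n \<or> even n \<and> mover_loses_in_round \<omega> \<sigma> \<tau> n)"

definition game_won :: "configuration \<Rightarrow> bool" where
  "game_won \<omega> \<longleftrightarrow> (\<exists>\<sigma>. strategy \<omega> \<sigma> \<and> (\<forall>\<tau>. strategy \<omega> \<tau> \<longrightarrow> first_wins_play \<omega> \<sigma> \<tau>))"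

definition game_lost :: "configuration \<Rightarrow> bool" where
  "game_lost \<omega> \<longleftrightarrow> (\<exists>\<tau>. strategy \<omega> \<tau> \<and> (\<forall>\<sigma>. strategy \<omega> \<sigma> \<longrightarrow> second_wins_play \<omega> \<sigma> \<tau>))"

definition game_drawn :: "configuration \<Rightarrow> bool" where
  "game_drawn \<omega> \<longleftrightarrow> \<not> game_won \<omega> \<and> \<not> game_lost \<omega>"

definition label_pmf :: "real \<Rightarrow> real \<Rightarrow> label pmf" where
  "label_pmf p q = embed_pmf (\<lambda>l. case l of Trap \<Rightarrow> p | Target \<Rightarrow> q | Safe \<Rightarrow> 1 - p - q)"

lemma pmf_label_pmf:
  assumes "0 \<le> p" "0 \<le> q" "p + q \<le> 1"
  shows "pmf (label_pmf p q) Trap = p" "pmf (label_pmf p q) Target = q"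
    "pmf (label_pmf p q) Safe = 1 - p - q"
proof -
  let ?f = "\<lambda>l. case l of Trap \<Rightarrow> p | Target \<Rightarrow> q | Safe \<Rightarrow> 1 - p - q"
  have U: "(UNIV :: label set) = {Trap, Target, Safe}"
    using label.exhaust by auto
  have nn: "0 \<le> ?f l" for l
    using assms by (cases l) auto
  have "(\<integral>\<^sup>+l. ennreal (?f l) \<partial>count_space UNIV) = (\<Sum>l\<in>UNIV. ennreal (?f l))"
    by (rule nn_integral_count_space_finite) (simp add: U)
  also have "\<dots> = ennreal (\<Sum>l\<in>UNIV. ?f l)"
    using nn by (rule sum_ennreal)
  also have "\<dots> = 1"
    by (simp add: U)
  finally have "pmf (label_pmf p q) l = ?f l" for l
    unfolding label_pmf_def using nn by (intro pmf_embed_pmf)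
  then show "pmf (label_pmf p q) Trap = p" "pmf (label_pmf p q) Target = q"
    "pmf (label_pmf p q) Safe = 1 - p - q"
    by simp_all
qed

text \<open>
  All numbers of children and all edge labels are independent.  Attaching data also to potential
  vertices outside the tree does not change the law of the labelled Galton--Watson tree.
\<close>

definition game_space :: "nat pmf \<Rightarrow> real \<Rightarrow> real \<Rightarrow> configuration measure" where
  "game_space chi p q =
     PiM (UNIV :: vertex set) (\<lambda>_. measure_pmf (pair_pmf chi (label_pmf p q)))"

definition win_prob :: "nat pmf \<Rightarrow> real \<Rightarrow> real \<Rightarrow> real" where
  "win_prob chi p q = measure (game_space chi p q) {\<omega> \<in> space (game_space chi p q). game_won \<omega>}"

definition loss_prob :: "nat pmf \<Rightarrow> real \<Rightarrow> real \<Rightarrow> real" where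
  "loss_prob chi p q = measure (game_space chi p q) {\<omega> \<in> space (game_space chi p q). game_lost \<omega>}"

definition draw_prob :: "nat pmf \<Rightarrow> real \<Rightarrow> real \<Rightarrow> real" where
  "draw_prob chi p q = measure (game_space chi p q) {\<omega> \<in> space (game_space chi p q). game_drawn \<omega>}"

definition pgf :: "nat pmf \<Rightarrow> real \<Rightarrow> real" where
  "pgf chi x = (\<Sum>m. x ^ m * pmf chi m)"

definition g :: "nat pmf \<Rightarrow> real \<Rightarrow> real \<Rightarrow> real \<Rightarrow> real" where
  "g chi p q x = (1 - q) - (1 - p - q) * pgf chi x"

end

theory Submission
  imports Defs
begin

text \<open>
  Backward induction reduces the game to the events that the player to move at a vertex wins
  (loses) within finitely many rounds.  At depth \<open>n + 1\<close> this depends on the number of children, on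
  the labels of the edges to them and on the depth-\<open>n\<close> events at the children, and the latter are
  independent.  This gives the recursion \<open>w\<^sub>n\<^sub>+\<^sub>1 = 1 - G (1 - q - r l\<^sub>n)\<close> and
  \<open>l\<^sub>n\<^sub>+\<^sub>1 = G (p + r w\<^sub>n)\<close> with \<open>r = 1 - p - q\<close>, started at \<open>0\<close>; in the limit \<open>w'\<close> is a fixed point of
  \<open>g \<circ> g\<close>.  Since \<open>g\<close> is decreasing, \<open>p + r w\<^sub>n \<le> x\<close> and \<open>g x \<le> 1 - q - r l\<^sub>n\<close> persist along the
  recursion for every fixed point \<open>x\<close>, so \<open>w'\<close> is the least one.  The draw probability times \<open>r\<close> is
  \<open>g w' - w'\<close>.  If this is nonzero, then \<open>g w'\<close> is a second fixed point; if it is zero and \<open>x\<close> is a fixed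
  point, then \<open>w' \<le> g x \<le> g w' = w'\<close>, hence \<open>x = w'\<close>.
\<close>

section \<open>Backward induction\<close>

text \<open>Both predicates are false at depth 0, so a leaf is lost from depth 1 on, by the empty
  quantifier. They are evaluated at every potential vertex, in the tree or not, which makes their
  law the same at all vertices.\<close>

fun wins_within :: "nat \<Rightarrow> configuration \<Rightarrow> vertex \<Rightarrow> bool"
  and loses_within :: "nat \<Rightarrow> configuration \<Rightarrow> vertex \<Rightarrow> bool" where
  "wins_within 0 \<omega> v \<longleftrightarrow> False"
| "wins_within (Suc n) \<omega> v \<longleftrightarrow>
     (\<exists>i<fst (\<omega> v). snd (\<omega> (v @ [i])) = Target \<or>
        snd (\<omega> (v @ [i])) = Safe \<and> loses_within n \<omega> (v @ [i]))"
| "loses_within 0 \<omega> v \<longleftrightarrow> False"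
| "loses_within (Suc n) \<omega> v \<longleftrightarrow>
     (\<forall>i<fst (\<omega> v). snd (\<omega> (v @ [i])) = Trap \<or>
        snd (\<omega> (v @ [i])) = Safe \<and> wins_within n \<omega> (v @ [i]))"

definition wins :: "configuration \<Rightarrow> vertex \<Rightarrow> bool" where
  "wins \<omega> v \<longleftrightarrow> (\<exists>n. wins_within n \<omega> v)"

definition loses :: "configuration \<Rightarrow> vertex \<Rightarrow> bool" where
  "loses \<omega> v \<longleftrightarrow> (\<exists>n. loses_within n \<omega> v)"

lemma within_Suc:
  "(wins_within n \<omega> v \<longrightarrow> wins_within (Suc n) \<omega> v) \<and>
   (loses_within n \<omega> v \<longrightarrow> loses_within (Suc n) \<omega> v)"
proof (induction n arbitrary: v)
  case (Suc n)
  then show ?case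
    unfolding wins_within.simps(2)[of "Suc n"] wins_within.simps(2)[of n]
      loses_within.simps(2)[of "Suc n"] loses_within.simps(2)[of n]
    by meson
qed auto

lemma wins_within_mono: "wins_within m \<omega> v \<Longrightarrow> m \<le> n \<Longrightarrow> wins_within n \<omega> v"
  using lift_Suc_mono_le[of "\<lambda>n. wins_within n \<omega> v" m n] within_Suc by auto

lemma loses_within_mono: "loses_within m \<omega> v \<Longrightarrow> m \<le> n \<Longrightarrow> loses_within n \<omega> v"
  using lift_Suc_mono_le[of "\<lambda>n. loses_within n \<omega> v" m n] within_Suc by auto

lemma not_wins_within_and_loses_within: "\<not> (wins_within n \<omega> v \<and> loses_within n \<omega> v)"
proof (induction n arbitrary: v)
  case (Suc n)
  then show ?case by auto
qed auto

lemma not_wins_and_loses: "\<not> (wins \<omega> v \<and> loses \<omega> v)"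
proof
  assume "wins \<omega> v \<and> loses \<omega> v"
  then obtain m n where "wins_within m \<omega> v" "loses_within n \<omega> v"
    by (auto simp: wins_def loses_def)
  then have "wins_within (max m n) \<omega> v" "loses_within (max m n) \<omega> v"
    by (auto intro: wins_within_mono loses_within_mono)
  then show False
    using not_wins_within_and_loses_within by blast
qed

lemma mem_children_iff: "u \<in> children \<omega> v \<longleftrightarrow> (\<exists>i<fst (\<omega> v). u = v @ [i])"
  by (auto simp: children_def)

lemma winsI:
  assumes "u \<in> children \<omega> v"
    and "edge_label \<omega> u = Target \<or> edge_label \<omega> u = Safe \<and> loses \<omega> u"
  shows "wins \<omega> v"
proof -
  obtain i where i: "i < fst (\<omega> v)" "u = v @ [i]"
    using assms(1) by (auto simp: mem_children_iff)
  obtain n where "edge_label \<omega> u = Target \<or> edge_label \<omega> u = Safe \<and> loses_within n \<omega> u"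
    using assms(2) by (auto simp: loses_def)
  then have "wins_within (Suc n) \<omega> v"
    using i by (auto simp: edge_label_def)
  then show ?thesis
    unfolding wins_def by blast
qed

text \<open>Here it matters that every vertex has only finitely many children.\<close>

lemma losesI:
  assumes "\<And>u. u \<in> children \<omega> v \<Longrightarrow>
      edge_label \<omega> u = Trap \<or> edge_label \<omega> u = Safe \<and> wins \<omega> u"
  shows "loses \<omega> v"
proof -
  have "\<exists>n. snd (\<omega> (v @ [i])) = Trap \<or> snd (\<omega> (v @ [i])) = Safe \<and> wins_within n \<omega> (v @ [i])"
    if "i < fst (\<omega> v)" for i
    using assms[of "v @ [i]"] that by (auto simp: mem_children_iff edge_label_def wins_def)
  then obtain N where N: "\<And>i. i < fst (\<omega> v) \<Longrightarrow> snd (\<omega> (v @ [i])) = Trap \<or>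
      snd (\<omega> (v @ [i])) = Safe \<and> wins_within (N i) \<omega> (v @ [i])"
    by metis
  \<comment> \<open>Inserting \<open>0\<close> keeps the set nonempty when \<open>v\<close> is a
    leaf.\<close>
  define K where "K = Max (insert 0 (N ` {..<fst (\<omega> v)}))"
  have "N i \<le> K" if "i < fst (\<omega> v)" for i
    unfolding K_def using that by (intro Max_ge) auto
  then have "loses_within (Suc K) \<omega> v"
    using N wins_within_mono by fastforce
  then show ?thesis
    unfolding loses_def by blast
qed

section \<open>Optimal strategies\<close>

text \<open>The player \<open>b\<close> is the first player if \<open>b\<close> holds and the second player otherwise.\<close>

definition wins_play ::
    "bool \<Rightarrow> configuration \<Rightarrow> (vertex \<Rightarrow> vertex) \<Rightarrow> (vertex \<Rightarrow> vertex) \<Rightarrow> bool" where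
  "wins_play b \<omega> \<sigma> \<tau> \<longleftrightarrow>
     (\<exists>n. even n = b \<and> mover_wins_in_round \<omega> \<sigma> \<tau> n \<or> even n \<noteq> b \<and> mover_loses_in_round \<omega> \<sigma> \<tau> n)"

lemma first_wins_play_eq: "first_wins_play = wins_play True"
  by (simp add: fun_eq_iff first_wins_play_def wins_play_def)

lemma second_wins_play_eq: "second_wins_play = wins_play False"
  by (simp add: fun_eq_iff second_wins_play_def wins_play_def)

text \<open>The fallback to an arbitrary child keeps the choice legal at vertices where no child
  satisfies \<open>P\<close>, since \<open>strategy\<close> constrains every inner vertex of the
  tree.\<close>

definition pick_child :: "(vertex \<Rightarrow> bool) \<Rightarrow> configuration \<Rightarrow> vertex \<Rightarrow> vertex" where
  "pick_child P \<omega> v =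
     (if \<exists>u\<in>children \<omega> v. P u then SOME u. u \<in> children \<omega> v \<and> P u
      else SOME u. u \<in> children \<omega> v)"

lemma pick_child_satisfies:
  assumes "\<exists>u\<in>children \<omega> v. P u"
  shows "pick_child P \<omega> v \<in> children \<omega> v" "P (pick_child P \<omega> v)"
  using someI_ex[of "\<lambda>u. u \<in> children \<omega> v \<and> P u"] assms by (auto simp: pick_child_def)

lemma pick_child_in_children: "children \<omega> v \<noteq> {} \<Longrightarrow> pick_child P \<omega> v \<in> children \<omega> v"
  using pick_child_satisfies(1)[of \<omega> v P] some_in_eq[of "children \<omega> v"]
  by (cases "\<exists>u\<in>children \<omega> v. P u") (auto simp: pick_child_def)

text \<open>
  Choosing a child that merely satisfies \<open>loses\<close> would not force the game to end; descending
  along the least depth does.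
\<close>

definition winning_strategy :: "configuration \<Rightarrow> vertex \<Rightarrow> vertex" where
  "winning_strategy \<omega> v =
     (let n = (LEAST n. wins_within n \<omega> v) - 1
      in pick_child (\<lambda>u. edge_label \<omega> u = Target \<or> edge_label \<omega> u = Safe \<and> loses_within n \<omega> u) \<omega> v)"

lemma strategy_winning_strategy: "strategy \<omega> (winning_strategy \<omega>)"
  by (simp add: strategy_def winning_strategy_def Let_def pick_child_in_children)

text \<open>The strategy itself uses only the least depth at \<open>v\<close>, but monotonicity in
  the depth turns this into a statement about any bound \<open>n\<close>. An induction along a play
  can thus carry whatever bound it has, lowering it by one per round.\<close>

lemma winning_strategy_step:
  assumes "wins_within n \<omega> v"
  obtains m where "n = Suc m" "winning_strategy \<omega> v \<in> children \<omega> v"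
    "edge_label \<omega> (winning_strategy \<omega> v) = Target \<or>
     edge_label \<omega> (winning_strategy \<omega> v) = Safe \<and> loses_within m \<omega> (winning_strategy \<omega> v)"
proof -
  define k where "k = (LEAST n. wins_within n \<omega> v)"
  have k: "wins_within k \<omega> v" "k \<le> n"
    unfolding k_def using assms by (rule LeastI, rule Least_le)
  then obtain l where l: "k = Suc l"
    by (cases k) auto
  obtain m where m: "n = Suc m"
    using assms by (cases n) auto
  let ?P = "\<lambda>u. edge_label \<omega> u = Target \<or> edge_label \<omega> u = Safe \<and> loses_within l \<omega> u"
  have "\<exists>u\<in>children \<omega> v. ?P u"
    using k(1) by (auto simp: l children_def edge_label_def)
  then have "winning_strategy \<omega> v \<in> children \<omega> v" "?P (winning_strategy \<omega> v)"
    unfolding winning_strategy_def Let_def k_def[symmetric] l diff_Suc_1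
    using pick_child_satisfies[of \<omega> v ?P] by blast+
  moreover have "l \<le> m"
    using k l m by simp
  ultimately show ?thesis
    using that m loses_within_mono by blast
qed

lemma strategyD: "strategy \<omega> \<sigma> \<Longrightarrow> v \<in> gw_tree \<omega> \<Longrightarrow> children \<omega> v \<noteq> {} \<Longrightarrow> \<sigma> v \<in> children \<omega> v"
  by (simp add: strategy_def)

declare position.simps(2) [simp del]

lemma position_in_gw_tree:
  assumes "strategy \<omega> \<sigma>" "strategy \<omega> \<tau>" "reaches_round \<omega> \<sigma> \<tau> n"
  shows "position \<sigma> \<tau> n \<in> gw_tree \<omega>"
  using assms(3)
proof (induction n)
  case 0
  then show ?case by (simp add: gw_tree.root)
next
  case (Suc n)
  then have "position \<sigma> \<tau> n \<in> gw_tree \<omega>" "children \<omega> (position \<sigma> \<tau> n) \<noteq> {}"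
    by (auto simp: reaches_round_def)
  then have "position \<sigma> \<tau> (Suc n) \<in> children \<omega> (position \<sigma> \<tau> n)"
    using assms(1,2) by (simp add: position.simps(2) strategyD)
  with \<open>position \<sigma> \<tau> n \<in> gw_tree \<omega>\<close> show ?case
    by (rule gw_tree.child)
qed

lemma position_Suc_in_children:
  assumes "strategy \<omega> \<sigma>" "strategy \<omega> \<tau>" "reaches_round \<omega> \<sigma> \<tau> n"
    and "children \<omega> (position \<sigma> \<tau> n) \<noteq> {}"
  shows "position \<sigma> \<tau> (Suc n) \<in> children \<omega> (position \<sigma> \<tau> n)"
  using position_in_gw_tree[OF assms(1-3)] assms by (simp add: position.simps(2) strategyD)

lemma reaches_round_Suc:
  "reaches_round \<omega> \<sigma> \<tau> (Suc n) \<longleftrightarrow> reaches_round \<omega> \<sigma> \<tau> n \<and>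
     children \<omega> (position \<sigma> \<tau> n) \<noteq> {} \<and> edge_label \<omega> (position \<sigma> \<tau> (Suc n)) = Safe"
  by (auto simp: reaches_round_def less_Suc_eq)

text \<open>The condition \<open>even k = b\<close> says that player \<open>b\<close> moves in round
  \<open>k\<close>. Each safe move lowers the depth by one: the strategy does so for player
  \<open>b\<close>, and every safe move of the opponent does so because the opponent's vertex is
  lost within the bound. Depth 0 contradicts the hypothesis, so the play ends before the bound is
  used up, and every way for it to end favours \<open>b\<close>.\<close>

lemma winning_strategy_wins:
  assumes st: "strategy \<omega> \<sigma>" "strategy \<omega> \<tau>"
    and b: "(if b then \<sigma> else \<tau>) = winning_strategy \<omega>"
    and "reaches_round \<omega> \<sigma> \<tau> k"
    and "if even k = b then wins_within n \<omega> (position \<sigma> \<tau> k)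
         else loses_within n \<omega> (position \<sigma> \<tau> k)"
  shows "wins_play b \<omega> \<sigma> \<tau>"
  using assms(4,5)
proof (induction n arbitrary: k)
  case 0
  then show ?case by (simp split: if_splits)
next
  case (Suc n)
  let ?v = "position \<sigma> \<tau> k" and ?u = "position \<sigma> \<tau> (Suc k)"
  show ?case
  proof (cases "even k = b")
    case True
    then have u: "?u = winning_strategy \<omega> ?v"
      using b by (auto simp: position.simps(2) split: if_splits)
    have "wins_within (Suc n) \<omega> ?v"
      using Suc.prems True by simp
    then have *: "?u \<in> children \<omega> ?v"
      "edge_label \<omega> ?u = Target \<or> edge_label \<omega> ?u = Safe \<and> loses_within n \<omega> ?u"
      unfolding u by (blast elim: winning_strategy_step)+
    show ?thesis
    proof (cases "edge_label \<omega> ?u = Target")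
      case target: True
      have "mover_wins_in_round \<omega> \<sigma> \<tau> k"
        using Suc.prems(1) *(1) target by (auto simp: mover_wins_in_round_def)
      then show ?thesis
        using True by (auto simp: wins_play_def)
    next
      case False
      then have "edge_label \<omega> ?u = Safe" "loses_within n \<omega> ?u"
        using *(2) by auto
      moreover have "reaches_round \<omega> \<sigma> \<tau> (Suc k)"
        using *(1) \<open>edge_label \<omega> ?u = Safe\<close> Suc.prems(1) by (auto simp: reaches_round_Suc)
      ultimately show ?thesis
        using True by (intro Suc.IH[of "Suc k"]) auto
    qed
  next
    case False
    then have l: "loses_within (Suc n) \<omega> ?v"
      using Suc.prems by simp
    show ?thesis
    proof (cases "children \<omega> ?v = {} \<or> edge_label \<omega> ?u = Trap")
      case True
      then have "mover_loses_in_round \<omega> \<sigma> \<tau> k"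
        using Suc.prems(1) by (auto simp: mover_loses_in_round_def)
      then show ?thesis
        using False by (auto simp: wins_play_def)
    next
      case safe: False
      then have "?u \<in> children \<omega> ?v"
        using position_Suc_in_children[OF st Suc.prems(1)] by blast
      then have u: "edge_label \<omega> ?u = Safe" "wins_within n \<omega> ?u"
        using l safe unfolding mem_children_iff edge_label_def loses_within.simps by metis+
      then have "reaches_round \<omega> \<sigma> \<tau> (Suc k)"
        using safe Suc.prems(1) by (simp add: reaches_round_Suc)
      then show ?thesis
        using False u by (intro Suc.IH[of "Suc k"]) auto
    qed
  qed
qed

text \<open>The aim is only to deny the opponent a win, possibly by playing forever, so no depth has
  to be tracked here.\<close>

definition avoiding_strategy :: "configuration \<Rightarrow> vertex \<Rightarrow> vertex" where
  "avoiding_strategy \<omega> =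
     pick_child (\<lambda>u. edge_label \<omega> u = Target \<or> edge_label \<omega> u = Safe \<and> \<not> wins \<omega> u) \<omega>"

lemma strategy_avoiding_strategy: "strategy \<omega> (avoiding_strategy \<omega>)"
  by (simp add: strategy_def avoiding_strategy_def pick_child_in_children)

text \<open>Contrapositive of \<open>losesI\<close>: if no child were good, every edge would be a
  trap or a safe edge to a winning vertex, and \<open>v\<close> would be lost. In particular
  \<open>v\<close> is not a leaf. Finite branching enters through \<open>losesI\<close>.\<close>

lemma avoiding_strategy_step:
  assumes "\<not> loses \<omega> v"
  shows "avoiding_strategy \<omega> v \<in> children \<omega> v"
    "edge_label \<omega> (avoiding_strategy \<omega> v) = Target \<or>
     edge_label \<omega> (avoiding_strategy \<omega> v) = Safe \<and> \<not> wins \<omega> (avoiding_strategy \<omega> v)"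
proof -
  let ?P = "\<lambda>u. edge_label \<omega> u = Target \<or> edge_label \<omega> u = Safe \<and> \<not> wins \<omega> u"
  have "\<exists>u\<in>children \<omega> v. ?P u"
    using assms losesI[of \<omega> v] label.exhaust by metis
  then show "avoiding_strategy \<omega> v \<in> children \<omega> v" "?P (avoiding_strategy \<omega> v)"
    unfolding avoiding_strategy_def using pick_child_satisfies[of \<omega> v ?P] by blast+
qed

text \<open>Here \<open>b\<close> is the player who is denied the win, and the other one follows the
  avoiding strategy. The invariant is that \<open>b\<close> never moves from a vertex in
  \<open>wins\<close> and the other player never moves from one in \<open>loses\<close>. By
  \<open>winsI\<close> a safe move of \<open>b\<close> cannot reach a lost vertex, and by the
  previous lemma the avoiding move cannot reach a won one. A target move of \<open>b\<close>, or a
  leaf or trap for the other player, would violate these facts.\<close>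

lemma avoiding_strategy_avoids:
  assumes st: "strategy \<omega> \<sigma>" "strategy \<omega> \<tau>"
    and b: "(if b then \<tau> else \<sigma>) = avoiding_strategy \<omega>"
    and start: "if b then \<not> wins \<omega> [] else \<not> loses \<omega> []"
  shows "\<not> wins_play b \<omega> \<sigma> \<tau>"
proof -
  have inv: "if even k = b then \<not> wins \<omega> (position \<sigma> \<tau> k) else \<not> loses \<omega> (position \<sigma> \<tau> k)"
    if "reaches_round \<omega> \<sigma> \<tau> k" for k
    using that
  proof (induction k)
    case 0
    then show ?case using start by simp
  next
    case (Suc k)
    let ?v = "position \<sigma> \<tau> k" and ?u = "position \<sigma> \<tau> (Suc k)"
    have r: "reaches_round \<omega> \<sigma> \<tau> k" "children \<omega> ?v \<noteq> {}" "edge_label \<omega> ?u = Safe"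
      using Suc.prems by (auto simp: reaches_round_Suc)
    show ?case
    proof (cases "even k = b")
      case True
      then show ?thesis
        using Suc.IH[OF r(1)] winsI[OF position_Suc_in_children[OF st r(1,2)]] r(3) by auto
    next
      case False
      then have u: "?u = avoiding_strategy \<omega> ?v"
        using b by (auto simp: position.simps(2) split: if_splits)
      have "\<not> loses \<omega> ?v"
        using Suc.IH[OF r(1)] False by simp
      then show ?thesis
        using avoiding_strategy_step[of \<omega> ?v] False r(3) unfolding u[symmetric] by auto
    qed
  qed
  show ?thesis
  proof
    assume "wins_play b \<omega> \<sigma> \<tau>"
    then consider k where "even k = b" "mover_wins_in_round \<omega> \<sigma> \<tau> k"
      | k where "even k \<noteq> b" "mover_loses_in_round \<omega> \<sigma> \<tau> k"
      by (auto simp: wins_play_def)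
    then show False
    proof cases
      case 1
      then show False
        using inv[of k] winsI[OF position_Suc_in_children[OF st, of k]]
        by (auto simp: mover_wins_in_round_def)
    next
      case 2
      let ?v = "position \<sigma> \<tau> k"
      have u: "position \<sigma> \<tau> (Suc k) = avoiding_strategy \<omega> ?v"
        using b 2(1) by (auto simp: position.simps(2) split: if_splits)
      have "\<not> loses \<omega> ?v"
        using inv[of k] 2 by (simp add: mover_loses_in_round_def)
      then show False
        using avoiding_strategy_step[of \<omega> ?v] 2(2)
        unfolding u[symmetric] by (auto simp: mover_loses_in_round_def)
    qed
  qed
qed

text \<open>If the root is not in \<open>wins\<close>, the avoiding strategy of the second player
  refutes every candidate strategy of the first. Conversely, the depth-descending strategy wins from
  round 0.\<close>

lemma game_won_iff_wins: "game_won \<omega> \<longleftrightarrow> wins \<omega> []"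
proof
  assume "game_won \<omega>"
  then obtain \<sigma> where "strategy \<omega> \<sigma>" "\<And>\<tau>. strategy \<omega> \<tau> \<Longrightarrow> wins_play True \<omega> \<sigma> \<tau>"
    by (auto simp: game_won_def first_wins_play_eq)
  then show "wins \<omega> []"
    using avoiding_strategy_avoids[of \<omega> \<sigma> "avoiding_strategy \<omega>" True]
      strategy_avoiding_strategy[of \<omega>] by auto
next
  assume "wins \<omega> []"
  then obtain n where "wins_within n \<omega> []"
    by (auto simp: wins_def)
  then have "wins_play True \<omega> (winning_strategy \<omega>) \<tau>" if "strategy \<omega> \<tau>" for \<tau>
    using that strategy_winning_strategy[of \<omega>]
    by (intro winning_strategy_wins[where k = 0 and n = n]) (auto simp: reaches_round_def)
  then show "game_won \<omega>"
    using strategy_winning_strategy[of \<omega>] by (auto simp: game_won_def first_wins_play_eq)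
qed

lemma game_lost_iff_loses: "game_lost \<omega> \<longleftrightarrow> loses \<omega> []"
proof
  assume "game_lost \<omega>"
  then obtain \<tau> where "strategy \<omega> \<tau>" "\<And>\<sigma>. strategy \<omega> \<sigma> \<Longrightarrow> wins_play False \<omega> \<sigma> \<tau>"
    by (auto simp: game_lost_def second_wins_play_eq)
  then show "loses \<omega> []"
    using avoiding_strategy_avoids[of \<omega> "avoiding_strategy \<omega>" \<tau> False]
      strategy_avoiding_strategy[of \<omega>] by auto
next
  assume "loses \<omega> []"
  then obtain n where "loses_within n \<omega> []"
    by (auto simp: loses_def)
  then have "wins_play False \<omega> \<sigma> (winning_strategy \<omega>)" if "strategy \<omega> \<sigma>" for \<sigma>
    using that strategy_winning_strategy[of \<omega>]
    by (intro winning_strategy_wins[where k = 0 and n = n]) (auto simp: reaches_round_def)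
  then show "game_lost \<omega>"
    using strategy_winning_strategy[of \<omega>] by (auto simp: game_lost_def second_wins_play_eq)
qed

section \<open>Probability generating functions\<close>

lemma pmf_sums_1: "pmf (chi :: nat pmf) sums 1"
  using measure_pmf.finite_measure_UNION[of "\<lambda>n. {n}" chi]
  by (simp add: disjoint_family_on_def measure_pmf_single)

lemma pgf_term_le: "x \<in> {0..1} \<Longrightarrow> x ^ m * pmf chi m \<le> pmf chi m"
  by (simp add: mult_left_le_one_le power_le_one)

lemma summable_pgf: "x \<in> {0..1} \<Longrightarrow> summable (\<lambda>m. x ^ m * pmf chi m)"
  using pgf_term_le[of x _ chi] by (intro summable_comparison_test'[OF sums_summable[OF pmf_sums_1]]) auto

lemma pgf_nonneg: "x \<in> {0..1} \<Longrightarrow> 0 \<le> pgf chi x"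
  unfolding pgf_def by (intro suminf_nonneg summable_pgf) auto

lemma pgf_le_1: "x \<in> {0..1} \<Longrightarrow> pgf chi x \<le> 1"
  unfolding pgf_def using suminf_le[OF pgf_term_le summable_pgf sums_summable[OF pmf_sums_1]]
  by (simp add: sums_unique[OF pmf_sums_1, symmetric])

lemma pgf_mono: "0 \<le> x \<Longrightarrow> x \<le> y \<Longrightarrow> y \<le> 1 \<Longrightarrow> pgf chi x \<le> pgf chi y"
  unfolding pgf_def by (intro suminf_le summable_pgf mult_right_mono power_mono) auto

text \<open>The masses of \<open>chi\<close> form a summable majorant of the terms on the closed
  interval, so the convergence is uniform up to and including the endpoint 1.\<close>

lemma continuous_on_pgf: "continuous_on {0..1} (pgf chi)"
proof -
  have "uniform_limit {0..1} (\<lambda>n x. \<Sum>m<n. x ^ m * pmf chi m) (pgf chi) sequentially"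
    unfolding pgf_def using pgf_term_le[of _ _ chi]
    by (intro Weierstrass_m_test[OF _ sums_summable[OF pmf_sums_1[of chi]]]) auto
  then show ?thesis
    by (rule uniform_limit_theorem[rotated]) (auto intro!: always_eventually continuous_intros)
qed

lemma pgf_less_1:
  assumes "pmf chi 0 < 1" "0 \<le> x" "x < 1"
  shows "pgf chi x < 1"
proof -
  have "\<exists>m. m \<noteq> 0 \<and> pmf chi m \<noteq> 0"
  proof (rule ccontr)
    assume "\<not> ?thesis"
    then have "pmf chi m = 0" if "m \<notin> {0}" for m
      using that by blast
    then have "pmf chi sums (\<Sum>m\<in>{0}. pmf chi m)"
      by (rule sums_finite[rotated]) simp_all
    then show False
      using assms(1) sums_unique2[OF pmf_sums_1[of chi], of "pmf chi 0"] by simp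
  qed
  then obtain m where m: "m \<noteq> 0" "0 < pmf chi m"
    using pmf_nonneg[of chi] by (metis less_eq_real_def)
  have sums: "(\<lambda>m. pmf chi m - x ^ m * pmf chi m) sums (1 - pgf chi x)"
    unfolding pgf_def using assms by (intro sums_diff pmf_sums_1 summable_sums summable_pgf) auto
  have "x ^ m < 1"
    using assms m(1) by (simp add: power_less_one_iff)
  then have "0 < pmf chi m - x ^ m * pmf chi m"
    using m(2) by simp
  then have "0 < (\<Sum>m. pmf chi m - x ^ m * pmf chi m)"
    using assms pgf_term_le[of x _ chi] sums_summable[OF sums] by (intro suminf_pos2[where i = m]) auto
  then show ?thesis
    using sums_unique[OF sums] by simp
qed

section \<open>The probabilities of winning and losing within a given depth\<close>

text \<open>The set \<open>range ((@) v)\<close> consists of \<open>v\<close> and all its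
  descendants. The events at \<open>v\<close> read only these coordinates, which is what lets events
  at different children be treated as independent.\<close>

lemma restrict_within:
  assumes "range ((@) v) \<subseteq> K"
  shows "wins_within n (restrict \<omega> K) v = wins_within n \<omega> v \<and>
    loses_within n (restrict \<omega> K) v = loses_within n \<omega> v"
  using assms
proof (induction n arbitrary: v)
  case (Suc n)
  have sub: "range ((@) (v @ [i])) \<subseteq> K" for i
    using Suc.prems by auto
  have mem: "v \<in> K" "v @ [i] \<in> K" for i
    using Suc.prems[THEN subsetD, OF rangeI, of "[]"] Suc.prems by auto
  show ?case
    unfolding wins_within.simps loses_within.simps Suc.IH[OF sub, THEN conjunct1]
      Suc.IH[OF sub, THEN conjunct2] restrict_apply'[OF mem(1)] restrict_apply'[OF mem(2)]
    by simp
qed simp_all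

lemma pred_PiM_component:
  assumes "v \<in> K"
  shows "Measurable.pred (PiM K (\<lambda>_. measure_pmf N)) (\<lambda>\<omega>. P (\<omega> v))"
proof -
  have "(\<lambda>\<omega>. \<omega> v) \<in> PiM K (\<lambda>_. measure_pmf N) \<rightarrow>\<^sub>M measure_pmf N"
    using assms by (rule measurable_component_singleton)
  then show ?thesis
    by (rule measurable_compose) simp
qed

text \<open>Measurability is shown on the product over any \<open>K\<close> containing the subtree,
  because independence is later applied to configurations restricted to a subtree.\<close>

lemma pred_within:
  assumes "range ((@) v) \<subseteq> K"
  shows "Measurable.pred (PiM K (\<lambda>_. measure_pmf N)) (\<lambda>\<omega>. wins_within n \<omega> v) \<and>
    Measurable.pred (PiM K (\<lambda>_. measure_pmf N)) (\<lambda>\<omega>. loses_within n \<omega> v)"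
  using assms
proof (induction n arbitrary: v)
  case (Suc n)
  have sub: "range ((@) (v @ [i])) \<subseteq> K" for i
    using Suc.prems by auto
  have mem: "v \<in> K" "v @ [i] \<in> K" for i
    using Suc.prems[THEN subsetD, OF rangeI, of "[]"] Suc.prems by auto
  note [measurable] = Suc.IH[OF sub, THEN conjunct1] Suc.IH[OF sub, THEN conjunct2]
  have [measurable]: "Measurable.pred (PiM K (\<lambda>_. measure_pmf N)) (\<lambda>\<omega>. i < fst (\<omega> v))"
    "Measurable.pred (PiM K (\<lambda>_. measure_pmf N)) (\<lambda>\<omega>. snd (\<omega> (v @ [i])) = l)" for i l
    using mem by (auto intro!: pred_PiM_component[where P = "\<lambda>x. i < fst x"]
        pred_PiM_component[where P = "\<lambda>x. snd x = l"])
  show ?case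
    unfolding wins_within.simps loses_within.simps by (intro conjI; measurable)
qed simp_all

section \<open>The probability space and the independence of subtrees\<close>

locale bond_percolation =
  fixes chi :: "nat pmf" and p q :: real
  assumes p_nonneg: "0 \<le> p" and q_nonneg: "0 \<le> q" and p_plus_q: "p + q \<le> 1"
begin

abbreviation "law \<equiv> pair_pmf chi (label_pmf p q)"
abbreviation "M \<equiv> game_space chi p q"

lemmas pmf_labels = pmf_label_pmf[OF p_nonneg q_nonneg p_plus_q]

lemma space_game_space: "space M = UNIV"
  by (simp add: game_space_def space_PiM)

sublocale prob_space M
  unfolding game_space_def by (intro prob_space_PiM measure_pmf.prob_space_axioms)

lemma pred_component [measurable]: "Measurable.pred M (\<lambda>\<omega>. P (\<omega> v))"
  unfolding game_space_def by (rule pred_PiM_component) simp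

lemma pred_wins_within [measurable]: "Measurable.pred M (\<lambda>\<omega>. wins_within n \<omega> v)"
  and pred_loses_within [measurable]: "Measurable.pred M (\<lambda>\<omega>. loses_within n \<omega> v)"
  unfolding game_space_def by (simp_all add: pred_within)

lemma events_Collect: "Measurable.pred M P \<Longrightarrow> {\<omega>. P \<omega>} \<in> sets M"
  by (simp add: pred_def space_game_space)

lemma component_measurable: "(\<lambda>\<omega>. \<omega> v) \<in> M \<rightarrow>\<^sub>M measure_pmf law"
  unfolding game_space_def by (rule measurable_component_singleton) simp

lemma distr_component: "distr M (measure_pmf law) (\<lambda>\<omega>. \<omega> v) = measure_pmf law"
  unfolding game_space_def
  by (rule distr_PiM_component) (simp_all add: measure_pmf.prob_space_axioms)

lemma prob_component: "prob {\<omega>. \<omega> v \<in> S} = measure_pmf.prob law S"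
proof -
  have "measure_pmf.prob law S = measure (distr M (measure_pmf law) (\<lambda>\<omega>. \<omega> v)) S"
    by (simp only: distr_component)
  also have "\<dots> = prob ((\<lambda>\<omega>. \<omega> v) -` S \<inter> space M)"
    using component_measurable by (rule measure_distr) simp
  finally show ?thesis
    by (simp add: space_game_space vimage_def)
qed

lemma prob_label: "prob {\<omega>. snd (\<omega> v) \<in> A} = measure_pmf.prob (label_pmf p q) A"
proof -
  have "prob {\<omega>. snd (\<omega> v) \<in> A} = measure_pmf.prob law (snd -` A)"
    using prob_component[of v "snd -` A"] by simp
  also have "\<dots> = measure_pmf.prob (map_pmf snd law) A"
    by simp
  finally show ?thesis
    by (simp only: map_snd_pair_pmf)
qed

text \<open>The joint law of all coordinates is the pushforward of \<open>M\<close> under the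
  identity, that is \<open>M\<close> itself, and \<open>M\<close> is the product of the marginals by
  \<open>distr_component\<close>.\<close>

lemma indep_vars_components: "indep_vars (\<lambda>_. measure_pmf law) (\<lambda>v \<omega>. \<omega> v) UNIV"
proof (subst indep_vars_iff_distr_eq_PiM)
  have "(\<lambda>\<omega>. restrict \<omega> UNIV) = (\<lambda>\<omega> :: configuration. \<omega>)"
    by (simp add: fun_eq_iff)
  moreover have "distr M M (\<lambda>\<omega>. \<omega>) = M"
    by (rule distr_id)
  ultimately show "distr M (\<Pi>\<^sub>M i\<in>UNIV. measure_pmf law) (\<lambda>\<omega>. \<lambda>v\<in>UNIV. \<omega> v) =
      (\<Pi>\<^sub>M i\<in>UNIV. distr M (measure_pmf law) (\<lambda>\<omega>. \<omega> i))"
    by (simp add: distr_component) (simp add: game_space_def)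
qed (rule UNIV_not_empty component_measurable)+

text \<open>
  Independence: the data at \<open>v\<close> and the subtrees hanging from the children of \<open>v\<close> involve
  disjoint sets of coordinates.
\<close>

lemma prob_all_children:
  assumes pred: "\<And>i. Measurable.pred (PiM (range ((@) (v @ [i]))) (\<lambda>_. measure_pmf law)) (E i)"
    and dep: "\<And>i \<omega>. E i (restrict \<omega> (range ((@) (v @ [i])))) = E i \<omega>"
    and prob_E: "\<And>i. prob {\<omega>. E i \<omega>} = e"
  shows "prob {\<omega>. snd (\<omega> v) \<in> A \<and> (\<forall>i<fst (\<omega> v). E i \<omega>)} =
    measure_pmf.prob (label_pmf p q) A * pgf chi e"
proof -
  have "(UNIV :: label set) = {Trap, Target, Safe}"
    using label.exhaust by auto
  then have "finite (UNIV :: label set)"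
    by (metis finite.emptyI finite_insert)
  then have "countable A"
    using finite_subset[OF subset_UNIV] countable_finite by blast
  \<comment> \<open>The index \<open>None\<close> stands for the data at \<open>v\<close> and
    \<open>Some i\<close> for the subtree at the potential child \<open>v @ [i]\<close>. All i are
    included, whatever the actual number of children, so the family of blocks is not random.\<close>
  define K where "K j = (case j of None \<Rightarrow> {v} | Some i \<Rightarrow> range ((@) (v @ [i])))" for j
  define X :: "nat option \<Rightarrow> configuration \<Rightarrow> configuration" where "X j \<omega> = restrict \<omega> (K j)" for j \<omega>
  let ?P = "\<lambda>j. PiM (K j) (\<lambda>_. measure_pmf law)"
  have "disjoint_family_on K UNIV"
    by (auto simp: disjoint_family_on_def K_def split: option.splits)
  then have "indep_vars ?P X UNIV"
    unfolding X_def using indep_vars_restrict[OF indep_vars_components, of UNIV K] by simp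
  \<comment> \<open>Fixing the number m of children makes the range of the quantifier deterministic,
    so \<open>B m\<close> is a finite intersection of independent events. Summing over m produces
    the series of \<open>pgf\<close>.\<close>
  define B where "B m = {\<omega>. fst (\<omega> v) = m \<and> snd (\<omega> v) \<in> A \<and> (\<forall>i<m. E i \<omega>)}" for m
  have X_meas: "X j \<in> M \<rightarrow>\<^sub>M ?P j" for j
    using \<open>indep_vars ?P X UNIV\<close> by (auto simp: indep_vars_def)
  have E_eq: "X (Some i) -` {\<omega> \<in> space (?P (Some i)). E i \<omega>} \<inter> space M = {\<omega>. E i \<omega>}" for i
    using measurable_space[OF X_meas[of "Some i"]] dep
    by (auto simp: space_game_space X_def K_def)
  have pred': "{\<omega> \<in> space (?P (Some i)). E i \<omega>} \<in> sets (?P (Some i))" for i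
    using pred[of i] by (simp add: K_def pred_def)
  have E_meas [measurable]: "Measurable.pred M (E i)" for i
    using measurable_sets[OF X_meas pred', of i] unfolding E_eq
    by (simp add: pred_def space_game_space)
  have B_prob: "prob (B m) = measure_pmf.prob (label_pmf p q) A * (e ^ m * pmf chi m)" for m
  proof -
    define S where "S j = (case j of None \<Rightarrow> {\<omega> \<in> space (?P j). \<omega> v \<in> {m} \<times> A}
        | Some i \<Rightarrow> {\<omega> \<in> space (?P j). E i \<omega>})" for j
    let ?J = "insert None (Some ` {..<m})"
    have S_sets: "S j \<in> sets (?P j)" for j
      using pred' pred_PiM_component[of v "{v}", where N = law and P = "\<lambda>x. x \<in> {m} \<times> A"]
      by (auto simp: S_def K_def pred_def split: option.split)
    have at_v: "X None -` S None \<inter> space M = {\<omega>. \<omega> v \<in> {m} \<times> A}"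
      using measurable_space[OF X_meas[of None]]
      by (auto simp: space_game_space X_def K_def S_def)
    have below: "X (Some i) -` S (Some i) \<inter> space M = {\<omega>. E i \<omega>}" for i
      using E_eq[of i] by (simp add: S_def)
    have "B m = {\<omega>. \<omega> v \<in> {m} \<times> A} \<inter> (\<Inter>i<m. {\<omega>. E i \<omega>})"
      by (auto simp: B_def mem_Times_iff)
    also have "\<dots> = (\<Inter>j\<in>?J. X j -` S j \<inter> space M)"
      by (simp only: at_v below INT_insert INF_image comp_def)
    also have "prob \<dots> = (\<Prod>j\<in>?J. prob (X j -` S j \<inter> space M))"
      by (rule indep_varsD[OF \<open>indep_vars ?P X UNIV\<close>]) (auto intro: S_sets)
    also have "\<dots> = prob {\<omega>. \<omega> v \<in> {m} \<times> A} * (\<Prod>i<m. prob {\<omega>. E i \<omega>})"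
      by (subst prod.insert) (auto simp: at_v below prod.reindex)
    also have "\<dots> = measure_pmf.prob law ({m} \<times> A) * e ^ m"
      by (simp only: prob_component prob_E) simp
    also have "measure_pmf.prob law ({m} \<times> A) = pmf chi m * measure_pmf.prob (label_pmf p q) A"
      using \<open>countable A\<close> by (simp add: measure_pmf_prob_product measure_pmf_single)
    finally show ?thesis by (simp add: ac_simps)
  qed
  have "Measurable.pred M (\<lambda>\<omega>. fst (\<omega> v) = m \<and> snd (\<omega> v) \<in> A \<and> (\<forall>i<m. E i \<omega>))" for m
    by measurable
  then have "range B \<subseteq> sets M"
    unfolding B_def using events_Collect by blast
  moreover have "disjoint_family B"
    by (auto simp: disjoint_family_on_def B_def)
  ultimately have "(\<lambda>m. prob (B m)) sums prob (\<Union>m. B m)"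
    by (rule finite_measure_UNION)
  moreover have "(\<Union>m. B m) = {\<omega>. snd (\<omega> v) \<in> A \<and> (\<forall>i<fst (\<omega> v). E i \<omega>)}"
    by (auto simp: B_def)
  ultimately have sums: "(\<lambda>m. measure_pmf.prob (label_pmf p q) A * (e ^ m * pmf chi m)) sums
      prob {\<omega>. snd (\<omega> v) \<in> A \<and> (\<forall>i<fst (\<omega> v). E i \<omega>)}"
    by (simp add: B_prob)
  have "e \<in> {0..1}"
    unfolding prob_E[of 0, symmetric] by simp
  then show ?thesis
    using summable_pgf[of e chi] sums_unique[OF sums] by (simp add: pgf_def suminf_mult)
qed

lemma prob_label_or:
  assumes "l \<noteq> Safe" "Measurable.pred M Q"
    and "prob {\<omega>. snd (\<omega> u) \<in> {Safe} \<and> Q \<omega>} = (1 - p - q) * x"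
  shows "prob {\<omega>. snd (\<omega> u) = l \<or> snd (\<omega> u) = Safe \<and> Q \<omega>} = pmf (label_pmf p q) l + (1 - p - q) * x"
proof -
  note [measurable] = assms(2)
  have "{\<omega>. snd (\<omega> u) = l \<or> snd (\<omega> u) = Safe \<and> Q \<omega>} =
      {\<omega>. snd (\<omega> u) \<in> {l}} \<union> {\<omega>. snd (\<omega> u) \<in> {Safe} \<and> Q \<omega>}"
    by auto
  also have "prob \<dots> = prob {\<omega>. snd (\<omega> u) \<in> {l}} + prob {\<omega>. snd (\<omega> u) \<in> {Safe} \<and> Q \<omega>}"
    using assms(1) by (intro finite_measure_Union events_Collect) (measurable, auto)
  finally show ?thesis
    by (simp only: prob_label assms(3) measure_pmf_single)
qed

lemma prob_not: "Measurable.pred M Q \<Longrightarrow> prob {\<omega>. \<not> Q \<omega>} = 1 - prob {\<omega>. Q \<omega>}"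
  using prob_compl[OF events_Collect[of Q]] by (simp add: space_game_space Compl_eq_Diff_UNIV[symmetric] Collect_neg_eq)

section \<open>The recursion for the finite-depth probabilities\<close>

abbreviation "win_within n \<equiv> prob {\<omega>. wins_within n \<omega> []}"
abbreviation "loss_within n \<equiv> prob {\<omega>. loses_within n \<omega> []}"

text \<open>The complement of winning is taken because a condition on all children factorises over
  independent subtrees. The label set \<open>A\<close> is carried along since the recursion one
  level up combines the label of the edge into \<open>v\<close> with the event below
  \<open>v\<close>.\<close>

lemma prob_label_not_wins_within_Suc:
  assumes "\<And>v. prob {\<omega>. snd (\<omega> v) \<in> {Safe} \<and> loses_within n \<omega> v} = (1 - p - q) * loss_within n"
  shows "prob {\<omega>. snd (\<omega> v) \<in> A \<and> \<not> wins_within (Suc n) \<omega> v} =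
    measure_pmf.prob (label_pmf p q) A * pgf chi (1 - q - (1 - p - q) * loss_within n)"
proof -
  let ?E = "\<lambda>i \<omega>. \<not> (snd (\<omega> (v @ [i])) = Target \<or> snd (\<omega> (v @ [i])) = Safe \<and> loses_within n \<omega> (v @ [i]))"
  let ?K = "\<lambda>i. range ((@) (v @ [i]))"
  have mem: "v @ [i] \<in> ?K i" for i
    by (rule range_eqI[of _ _ "[]"]) simp
  have "prob {\<omega>. snd (\<omega> v) \<in> A \<and> (\<forall>i<fst (\<omega> v). ?E i \<omega>)} =
    measure_pmf.prob (label_pmf p q) A * pgf chi (1 - q - (1 - p - q) * loss_within n)"
  proof (rule prob_all_children)
    fix i
    have [measurable]: "Measurable.pred (PiM (?K i) (\<lambda>_. measure_pmf law)) (\<lambda>\<omega>. snd (\<omega> (v @ [i])) = l)" for l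
      using pred_PiM_component[OF mem, where P = "\<lambda>x. snd x = l"] .
    note [measurable] = pred_within[OF subset_refl, THEN conjunct2]
    show "Measurable.pred (PiM (?K i) (\<lambda>_. measure_pmf law)) (?E i)"
      by measurable
    show "?E i (restrict \<omega> (?K i)) = ?E i \<omega>" for \<omega>
      by (simp only: restrict_apply'[OF mem] restrict_within[OF subset_refl, THEN conjunct2])
    show "prob {\<omega>. ?E i \<omega>} = 1 - q - (1 - p - q) * loss_within n"
      by (subst prob_not, measurable, subst prob_label_or[OF _ _ assms]) (auto simp: pmf_labels)
  qed
  then show ?thesis
    by simp
qed

lemma prob_label_loses_within_Suc:
  assumes "\<And>v. prob {\<omega>. snd (\<omega> v) \<in> {Safe} \<and> wins_within n \<omega> v} = (1 - p - q) * win_within n"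
  shows "prob {\<omega>. snd (\<omega> v) \<in> A \<and> loses_within (Suc n) \<omega> v} =
    measure_pmf.prob (label_pmf p q) A * pgf chi (p + (1 - p - q) * win_within n)"
proof -
  let ?E = "\<lambda>i \<omega>. snd (\<omega> (v @ [i])) = Trap \<or> snd (\<omega> (v @ [i])) = Safe \<and> wins_within n \<omega> (v @ [i])"
  let ?K = "\<lambda>i. range ((@) (v @ [i]))"
  have mem: "v @ [i] \<in> ?K i" for i
    by (rule range_eqI[of _ _ "[]"]) simp
  have "prob {\<omega>. snd (\<omega> v) \<in> A \<and> (\<forall>i<fst (\<omega> v). ?E i \<omega>)} =
    measure_pmf.prob (label_pmf p q) A * pgf chi (p + (1 - p - q) * win_within n)"
  proof (rule prob_all_children)
    fix i
    have [measurable]: "Measurable.pred (PiM (?K i) (\<lambda>_. measure_pmf law)) (\<lambda>\<omega>. snd (\<omega> (v @ [i])) = l)" for l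
      using pred_PiM_component[OF mem, where P = "\<lambda>x. snd x = l"] .
    note [measurable] = pred_within[OF subset_refl, THEN conjunct1]
    show "Measurable.pred (PiM (?K i) (\<lambda>_. measure_pmf law)) (?E i)"
      by measurable
    show "?E i (restrict \<omega> (?K i)) = ?E i \<omega>" for \<omega>
      by (simp only: restrict_apply'[OF mem] restrict_within[OF subset_refl, THEN conjunct1])
    show "prob {\<omega>. ?E i \<omega>} = p + (1 - p - q) * win_within n"
      by (subst prob_label_or[OF _ _ assms]) (auto simp: pmf_labels)
  qed
  then show ?thesis
    by simp
qed

lemma prob_label_and_not:
  assumes "Measurable.pred M Q"
    and "prob {\<omega>. snd (\<omega> v) \<in> A \<and> \<not> Q \<omega>} = measure_pmf.prob (label_pmf p q) A * x"
  shows "prob {\<omega>. snd (\<omega> v) \<in> A \<and> Q \<omega>} = measure_pmf.prob (label_pmf p q) A * (1 - x)"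
proof -
  note [measurable] = assms(1)
  have "{\<omega>. snd (\<omega> v) \<in> A} =
      {\<omega>. snd (\<omega> v) \<in> A \<and> Q \<omega>} \<union> {\<omega>. snd (\<omega> v) \<in> A \<and> \<not> Q \<omega>}"
    by auto
  also have "prob \<dots> = prob {\<omega>. snd (\<omega> v) \<in> A \<and> Q \<omega>} + prob {\<omega>. snd (\<omega> v) \<in> A \<and> \<not> Q \<omega>}"
    by (intro finite_measure_Union events_Collect) (measurable, auto)
  finally show ?thesis
    by (simp add: prob_label assms(2) algebra_simps)
qed

text \<open>Two facts are proved in one induction: the label of the edge into \<open>v\<close> is
  independent of the outcome below \<open>v\<close>, and the probability of that outcome is the same
  at \<open>v\<close> as at the root.\<close>

lemma prob_label_within:
  "(\<forall>v A. prob {\<omega>. snd (\<omega> v) \<in> A \<and> wins_within n \<omega> v} =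
      measure_pmf.prob (label_pmf p q) A * win_within n) \<and>
   (\<forall>v A. prob {\<omega>. snd (\<omega> v) \<in> A \<and> loses_within n \<omega> v} =
      measure_pmf.prob (label_pmf p q) A * loss_within n)"
proof (induction n)
  case (Suc n)
  have safe: "prob {\<omega>. snd (\<omega> v) \<in> {Safe} \<and> wins_within n \<omega> v} = (1 - p - q) * win_within n"
    "prob {\<omega>. snd (\<omega> v) \<in> {Safe} \<and> loses_within n \<omega> v} = (1 - p - q) * loss_within n" for v
    using Suc.IH[THEN conjunct1, THEN spec, THEN spec, of v "{Safe}"]
      Suc.IH[THEN conjunct2, THEN spec, THEN spec, of v "{Safe}"]
    by (simp_all only: measure_pmf_single pmf_labels)
  have w: "prob {\<omega>. snd (\<omega> v) \<in> A \<and> wins_within (Suc n) \<omega> v} =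
      measure_pmf.prob (label_pmf p q) A * (1 - pgf chi (1 - q - (1 - p - q) * loss_within n))" for v A
    by (intro prob_label_and_not prob_label_not_wins_within_Suc pred_wins_within safe)
  have l: "prob {\<omega>. snd (\<omega> v) \<in> A \<and> loses_within (Suc n) \<omega> v} =
      measure_pmf.prob (label_pmf p q) A * pgf chi (p + (1 - p - q) * win_within n)" for v A
    by (intro prob_label_loses_within_Suc safe)
  show ?case
    \<comment> \<open>At the root with \<open>A = UNIV\<close> the label factor is 1, which
      identifies the expressions in \<open>pgf\<close> with \<open>win_within (Suc n)\<close> and
      \<open>loss_within (Suc n)\<close>.\<close>
    using w[of "[]" UNIV] l[of "[]" UNIV] w l by simp
qed simp

lemma prob_safe_within:
  "prob {\<omega>. snd (\<omega> v) \<in> {Safe} \<and> wins_within n \<omega> v} = (1 - p - q) * win_within n"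
  "prob {\<omega>. snd (\<omega> v) \<in> {Safe} \<and> loses_within n \<omega> v} = (1 - p - q) * loss_within n"
  using prob_label_within[of n, THEN conjunct1, THEN spec, THEN spec, of v "{Safe}"]
    prob_label_within[of n, THEN conjunct2, THEN spec, THEN spec, of v "{Safe}"]
  by (simp_all only: measure_pmf_single pmf_labels)

lemma win_within_Suc: "win_within (Suc n) = 1 - pgf chi (1 - q - (1 - p - q) * loss_within n)"
proof -
  have "prob {\<omega>. \<not> wins_within (Suc n) \<omega> []} = pgf chi (1 - q - (1 - p - q) * loss_within n)"
    using prob_label_not_wins_within_Suc[OF prob_safe_within(2), of "[]" UNIV]
    by (simp del: wins_within.simps)
  then show ?thesis
    using prob_not[OF pred_wins_within[of "Suc n" "[]"]] by (simp del: wins_within.simps)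
qed

lemma loss_within_Suc: "loss_within (Suc n) = pgf chi (p + (1 - p - q) * win_within n)"
  using prob_label_loses_within_Suc[OF prob_safe_within(1), of "[]" UNIV]
  by (simp del: loses_within.simps)

section \<open>The limit of infinite depth\<close>

text \<open>The finite-depth events increase to the event \<open>game_won\<close> by backward
  induction, so continuity from below applies.\<close>

lemma win_prob_limit: "win_within \<longlonglongrightarrow> win_prob chi p q"
proof -
  have "incseq (\<lambda>n. {\<omega>. wins_within n \<omega> []})"
    by (auto simp: incseq_def intro: wins_within_mono)
  then have "win_within \<longlonglongrightarrow> prob (\<Union>n. {\<omega>. wins_within n \<omega> []})"
    by (intro finite_Lim_measure_incseq) (auto intro: events_Collect)
  also have "(\<Union>n. {\<omega>. wins_within n \<omega> []}) = {\<omega> \<in> space M. game_won \<omega>}"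
    by (auto simp: space_game_space game_won_iff_wins wins_def)
  finally show ?thesis
    by (simp only: win_prob_def)
qed

lemma loss_prob_limit: "loss_within \<longlonglongrightarrow> loss_prob chi p q"
proof -
  have "incseq (\<lambda>n. {\<omega>. loses_within n \<omega> []})"
    by (auto simp: incseq_def intro: loses_within_mono)
  then have "loss_within \<longlonglongrightarrow> prob (\<Union>n. {\<omega>. loses_within n \<omega> []})"
    by (intro finite_Lim_measure_incseq) (auto intro: events_Collect)
  also have "(\<Union>n. {\<omega>. loses_within n \<omega> []}) = {\<omega> \<in> space M. game_lost \<omega>}"
    by (auto simp: space_game_space game_lost_iff_loses loses_def)
  finally show ?thesis
    by (simp only: loss_prob_def)
qed

lemma draw_prob_eq: "draw_prob chi p q = 1 - win_prob chi p q - loss_prob chi p q"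
proof -
  let ?W = "{\<omega> \<in> space M. game_won \<omega>}" and ?L = "{\<omega> \<in> space M. game_lost \<omega>}"
  have W: "?W \<in> sets M"
    unfolding game_won_iff_wins wins_def by measurable
  have L: "?L \<in> sets M"
    unfolding game_lost_iff_loses loses_def by measurable
  have "{\<omega> \<in> space M. game_drawn \<omega>} = space M - (?W \<union> ?L)"
    by (auto simp: game_drawn_def)
  then have "draw_prob chi p q = 1 - prob (?W \<union> ?L)"
    using W L by (simp add: draw_prob_def prob_compl)
  also have "prob (?W \<union> ?L) = prob ?W + prob ?L"
    using W L not_wins_and_loses[of _ "[]"]
    by (intro finite_measure_Union) (auto simp: game_won_iff_wins game_lost_iff_loses)
  finally show ?thesis
    by (simp add: win_prob_def loss_prob_def)
qed

lemma in_unit_interval: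
  assumes "x \<in> {0..1}"
  shows "p + (1 - p - q) * x \<in> {0..1}" "1 - q - (1 - p - q) * x \<in> {0..1}"
proof -
  have "0 \<le> (1 - p - q) * x" "(1 - p - q) * x \<le> 1 - p - q"
    using assms p_plus_q by (auto intro: mult_left_le)
  then show "p + (1 - p - q) * x \<in> {0..1}" "1 - q - (1 - p - q) * x \<in> {0..1}"
    using p_nonneg q_nonneg p_plus_q by auto
qed

lemma win_prob_bounds: "win_prob chi p q \<in> {0..1}"
  and loss_prob_bounds: "loss_prob chi p q \<in> {0..1}"
  by (auto simp: win_prob_def loss_prob_def)

text \<open>Passage to the limit in \<open>win_within_Suc\<close>. Continuity of \<open>pgf\<close>
  is available on the unit interval only, so its arguments are checked to stay there.\<close>

lemma win_prob_eq: "win_prob chi p q = 1 - pgf chi (1 - q - (1 - p - q) * loss_prob chi p q)"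
proof (rule LIMSEQ_unique[OF LIMSEQ_Suc[OF win_prob_limit]])
  show "(\<lambda>n. win_within (Suc n)) \<longlonglongrightarrow> 1 - pgf chi (1 - q - (1 - p - q) * loss_prob chi p q)"
    unfolding win_within_Suc
    by (intro tendsto_intros continuous_on_tendsto_compose[OF continuous_on_pgf] loss_prob_limit
        in_unit_interval loss_prob_bounds always_eventually allI) auto
qed

lemma loss_prob_eq: "loss_prob chi p q = pgf chi (p + (1 - p - q) * win_prob chi p q)"
proof (rule LIMSEQ_unique[OF LIMSEQ_Suc[OF loss_prob_limit]])
  show "(\<lambda>n. loss_within (Suc n)) \<longlonglongrightarrow> pgf chi (p + (1 - p - q) * win_prob chi p q)"
    unfolding loss_within_Suc
    by (intro tendsto_intros continuous_on_tendsto_compose[OF continuous_on_pgf] win_prob_limit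
        in_unit_interval win_prob_bounds always_eventually allI) auto
qed

section \<open>Fixed points\<close>

abbreviation "h \<equiv> g chi p q"

lemma g_bounds:
  assumes "x \<in> {0..1}"
  shows "p \<le> h x" "h x \<le> 1 - q"
proof -
  have "0 \<le> (1 - p - q) * pgf chi x" "(1 - p - q) * pgf chi x \<le> 1 - p - q"
    using pgf_nonneg[OF assms, of chi] pgf_le_1[OF assms, of chi] p_plus_q
    by (auto intro: mult_left_le)
  then show "p \<le> h x" "h x \<le> 1 - q"
    by (auto simp: g_def)
qed

lemma g_mem: "x \<in> {0..1} \<Longrightarrow> h x \<in> {0..1}"
  using g_bounds[of x] p_nonneg q_nonneg by auto

lemma g_antimono: "0 \<le> x \<Longrightarrow> x \<le> y \<Longrightarrow> y \<le> 1 \<Longrightarrow> h y \<le> h x"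
  unfolding g_def using p_plus_q by (intro diff_mono mult_left_mono pgf_mono) auto

text \<open>This is the probability that an edge is a bad move: a trap, or a safe edge to a vertex
  from which the opponent wins.\<close>

definition w' where "w' = p + (1 - p - q) * win_prob chi p q"

lemma w'_mem: "w' \<in> {0..1}"
  unfolding w'_def by (intro in_unit_interval win_prob_bounds)

lemma loss_prob_eq_g: "(1 - p - q) * loss_prob chi p q = 1 - q - h w'"
  by (simp add: loss_prob_eq w'_def g_def)

text \<open>By \<open>loss_prob_eq_g\<close>, \<open>h w'\<close> is the probability that an edge is
  not a winning move, so the second application of \<open>h\<close> is the limit equation for
  winning.\<close>

lemma g_g_w': "h (h w') = w'"
proof -
  have "h w' = 1 - q - (1 - p - q) * loss_prob chi p q"
    using loss_prob_eq_g by simp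
  moreover have "pgf chi (1 - q - (1 - p - q) * loss_prob chi p q) = 1 - win_prob chi p q"
    by (simp add: win_prob_eq)
  ultimately have "h (h w') = (1 - q) - (1 - p - q) * (1 - win_prob chi p q)"
    by (simp only: g_def[of _ _ _ "1 - q - _"])
  then show ?thesis
    by (simp add: w'_def algebra_simps)
qed

lemma w'_le_fixed_point:
  assumes x: "x \<in> {0..1}" and fixed: "h (h x) = x"
  shows "w' \<le> x"
proof -
  have r: "0 \<le> 1 - p - q"
    using p_plus_q by simp
  have "p + (1 - p - q) * win_within n \<le> x \<and> h x \<le> 1 - q - (1 - p - q) * loss_within n" for n
  proof (induction n)
    case 0
    \<comment> \<open>At depth 0 both probabilities vanish, so the claim is \<open>p \<le> x\<close>
      and \<open>h x \<le> 1 - q\<close>. The first holds because \<open>x = h (h x)\<close> is a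
      value of \<open>h\<close>.\<close>
    show ?case
      using g_bounds[OF g_mem[OF x]] g_bounds[OF x] fixed by simp
  next
    case (Suc n)
    have W: "p + (1 - p - q) * win_within n \<in> {0..1}" "1 - q - (1 - p - q) * loss_within n \<in> {0..1}"
      by (intro in_unit_interval; simp)+
    have "p + (1 - p - q) * win_within (Suc n) = h (1 - q - (1 - p - q) * loss_within n)"
      unfolding win_within_Suc g_def by (simp add: algebra_simps)
    also have "\<dots> \<le> h (h x)"
      using Suc.IH W g_mem[OF x] by (intro g_antimono) auto
    finally have 1: "p + (1 - p - q) * win_within (Suc n) \<le> x"
      using fixed by simp
    have "h x \<le> h (p + (1 - p - q) * win_within n)"
      using Suc.IH W x by (intro g_antimono) auto
    also have "\<dots> = 1 - q - (1 - p - q) * loss_within (Suc n)"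
      unfolding loss_within_Suc g_def by (simp add: algebra_simps)
    finally show ?case
      using 1 by simp
  qed
  moreover have "(\<lambda>n. p + (1 - p - q) * win_within n) \<longlonglongrightarrow> w'"
    unfolding w'_def by (intro tendsto_intros win_prob_limit)
  ultimately show ?thesis
    by (intro LIMSEQ_le_const2) auto
qed

text \<open>As a value of \<open>h\<close>, \<open>w'\<close> is at least \<open>p\<close>, so
  \<open>w' = 0\<close> forces \<open>p = 0\<close> and hence q > 0. Then \<open>h w'\<close> is at
  most 1 - q < 1, where \<open>pgf\<close> is strictly below 1, while \<open>h (h w') = 0\<close>
  would require \<open>pgf\<close> to equal 1 there.\<close>

lemma w'_pos:
  assumes "pmf chi 0 < 1" "0 < p + q" "p + q < 1"
  shows "0 < w'"
proof (rule ccontr)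
  assume "\<not> 0 < w'"
  with w'_mem have "w' = 0"
    by auto
  moreover have "p \<le> w'"
    using g_bounds(1)[OF g_mem[OF w'_mem]] by (simp only: g_g_w')
  ultimately have "p = 0"
    using p_nonneg by simp
  then have "h w' < 1"
    using g_bounds(2)[OF w'_mem] assms(2) by simp
  then have "pgf chi (h w') < 1"
    using assms(1) g_mem[OF w'_mem] by (intro pgf_less_1) auto
  moreover have "h x = (1 - q) * (1 - pgf chi x)" for x
    using \<open>p = 0\<close> by (simp add: g_def algebra_simps)
  then have "(1 - q) * (1 - pgf chi (h w')) = 0"
    using g_g_w' \<open>w' = 0\<close> by metis
  ultimately show False
    using assms(3) \<open>p = 0\<close> by simp
qed

lemma draw_prob_eq_0_iff:
  assumes "p + q < 1"
  shows "draw_prob chi p q = 0 \<longleftrightarrow> h w' = w'"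
proof -
  have "(1 - p - q) * draw_prob chi p q = h w' - w'"
    using loss_prob_eq_g by (simp add: draw_prob_eq w'_def algebra_simps)
  moreover have "1 - p - q \<noteq> 0"
    using assms by simp
  ultimately show ?thesis
    by (metis eq_iff_diff_eq_0 mult_eq_0_iff)
qed

lemma g_w'_iff_unique_fixed_point:
  "h w' = w' \<longleftrightarrow> (\<exists>!x. 0 \<le> x \<and> x \<le> 1 \<and> h (h x) = x)"
proof
  assume w: "h w' = w'"
  show "\<exists>!x. 0 \<le> x \<and> x \<le> 1 \<and> h (h x) = x"
  proof (rule ex1I[of _ w'])
    show "0 \<le> w' \<and> w' \<le> 1 \<and> h (h w') = w'"
      using w'_mem g_g_w' by simp
  next
    fix x assume x: "0 \<le> x \<and> x \<le> 1 \<and> h (h x) = x"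
    \<comment> \<open>The second inequality is minimality again, since \<open>h x\<close> is also a
      fixed point of the twofold iterate.\<close>
    then have "w' \<le> x" "w' \<le> h x"
      using g_mem[of x] by (auto intro: w'_le_fixed_point)
    moreover from \<open>w' \<le> x\<close> have "h x \<le> h w'"
      using x w'_mem by (intro g_antimono) auto
    ultimately have "h x = w'"
      using w by simp
    then show "x = w'"
      using x w by metis
  qed
next
  assume "\<exists>!x. 0 \<le> x \<and> x \<le> 1 \<and> h (h x) = x"
  moreover have "0 \<le> w' \<and> w' \<le> 1 \<and> h (h w') = w'"
    using w'_mem g_g_w' by simp
  moreover have "0 \<le> h w' \<and> h w' \<le> 1 \<and> h (h (h w')) = h w'"
    using g_mem[OF w'_mem] g_g_w' by simp
  ultimately show "h w' = w'"
    by blast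
qed

end

theorem theorem1p1:
  fixes chi :: "nat pmf" and p q :: real
  assumes "pmf chi 0 < 1"
    and "0 \<le> p" "p \<le> 1" "0 \<le> q" "q \<le> 1"
    and "0 < p + q" "p + q < 1"
  shows "let g2 = g chi p q \<circ> g chi p q;
             w' = p + (1 - p - q) * win_prob chi p q;
             l' = (1 - p - q) * loss_prob chi p q
         in (0 < w' \<and> w' \<le> 1 \<and> g2 w' = w' \<and> (\<forall>x. 0 < x \<and> x \<le> 1 \<and> g2 x = x \<longrightarrow> w' \<le> x))
          \<and> l' = (1 - q) - g chi p q w'
          \<and> (draw_prob chi p q = 0 \<longleftrightarrow> (\<exists>!x. 0 \<le> x \<and> x \<le> 1 \<and> g2 x = x))"
proof -
  interpret bond_percolation chi p q
    using assms by unfold_locales auto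
  have "w' \<le> x" if "0 < x" "x \<le> 1" "h (h x) = x" for x
    using that by (intro w'_le_fixed_point) auto
  then show ?thesis
    using w'_mem w'_pos[OF assms(1,6,7)]
    unfolding Let_def comp_def w'_def[symmetric] loss_prob_eq_g draw_prob_eq_0_iff[OF assms(7)]
      g_w'_iff_unique_fixed_point[symmetric]
    by (simp add: g_g_w')
qed

end
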